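(* Let $X$ be a sequentially complete locally convex space, $T$ an nb-bounded linear operator on $X$, and $\lambda\in\mathbb{C}$. If $|\lambda|>r_{nb}(T)$, then $\lambda I-T$ is invertible and the Neumann series $\sum_{i=0}^\infty \frac{T^i}{\lambda^{i+1}}$ converges to $R_\lambda=(\lambda I-T)^{-1}$ uniformly on a zero neighborhood. Further, $|\sigma^{nb}(T)|\le r_{nb}(T)$.
   Context: Spaces are over $\mathbb{C}$; locally convex spaces are Hausdorff by definition. A linear operator is nb-bounded if it maps some zero neighborhood into a bounded set. A sequence $(S_n)$ of operators converges to zero uniformly on a set $A$ if for every zero neighborhood $V$ there is $n_0$ with $S_n(A)\subseteq V$ for all $n>n_0$; it converges to $S$ uniformly on $A$ if $(S_n-S)$ converges to zero uniformly on $A$; convergence of a series means convergence of its partial sums. $\rho^{nb}(T)$ is the set of $\lambda\in\mathbb{C}$ for which $\lambda I-T$ has a (two-sided) inverse of the form $\alpha I+S$ with $\alpha$ a scalar and $S$ an nb-bounded operator; $\sigma^{nb}(T)=\mathbb{C}\setminus\rho^{nb}(T)$. For $\sigma\subseteq\mathbb{C}$, $|\sigma|=\sup\{|\lambda| : \lambda\in\sigma\}$, with $\sup\emptyset=0$. The spectral radius is $$r_{nb}(T)=\inf\Bigl\{\nu>0 : \tfrac{T^n}{\nu^n}\to 0 \text{ uniformly on some zero neighborhood}\Bigr\},$$ with $\inf\emptyset=\infty$. *)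

theory Defs
  imports "HOL-Analysis.Analysis"
begin

text \<open>A complex vector space extends the library's real one, with compatible scalars, so that
  the library notion \<^const>\<open>convex\<close> is available.\<close>

class complex_vector = real_vector +
  fixes scaleC :: "complex \<Rightarrow> 'a \<Rightarrow> 'a"  (infixr "*\<^sub>C" 75)
  assumes scaleC_add_right: "c *\<^sub>C (x + y) = c *\<^sub>C x + c *\<^sub>C y"
    and scaleC_add_left: "(c + d) *\<^sub>C x = c *\<^sub>C x + d *\<^sub>C x"
    and scaleC_scaleC: "c *\<^sub>C (d *\<^sub>C x) = (c * d) *\<^sub>C x"
    and scaleC_one: "1 *\<^sub>C x = x"
    and scaleR_scaleC: "r *\<^sub>R x = complex_of_real r *\<^sub>C x"

definition zero_neighborhood :: "'a::{zero, topological_space} set \<Rightarrow> bool"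
  where "zero_neighborhood U \<longleftrightarrow> 0 \<in> interior U"

text \<open>Joint continuity of scalar multiplication is stated as the library states it for addition in
  \<^class>\<open>topological_monoid_add\<close>.\<close>

class complex_tvs = complex_vector + topological_ab_group_add + t2_space +
  assumes tendsto_scaleC_Pair:
    "LIM p (nhds c \<times>\<^sub>F nhds x). fst p *\<^sub>C snd p :> nhds (c *\<^sub>C x)"

text \<open>Class specifications restrict the sorts of the constants they may mention, so zero
  neighborhoods and the definition of \<^const>\<open>convex\<close> are written out here; the lemma below the
  class gives the folded form.\<close>

class locally_convex_space = complex_tvs +
  assumes locally_convex_unfolded:
    "open U \<Longrightarrow> 0 \<in> U \<Longrightarrow> \<exists>V W. open W \<and> 0 \<in> W \<and> W \<subseteq> V \<and> V \<subseteq> U \<and>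
      (\<forall>x\<in>V. \<forall>y\<in>V. \<forall>u\<ge>0. \<forall>v\<ge>0. u + v = 1 \<longrightarrow> u *\<^sub>R x + v *\<^sub>R y \<in> V)"

lemma locally_convex:
  fixes U :: "'a::locally_convex_space set"
  assumes "zero_neighborhood U"
  shows "\<exists>V. zero_neighborhood V \<and> convex V \<and> V \<subseteq> U"
  using locally_convex_unfolded[of "interior U"] assms interior_subset[of U]
  unfolding zero_neighborhood_def convex_def by (meson interiorI open_interior subset_trans)

definition tvs_Cauchy :: "(nat \<Rightarrow> 'a::locally_convex_space) \<Rightarrow> bool"
  where "tvs_Cauchy x \<longleftrightarrow>
    (\<forall>V. zero_neighborhood V \<longrightarrow> (\<exists>n0. \<forall>m\<ge>n0. \<forall>n\<ge>n0. x m - x n \<in> V))"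

definition sequentially_complete :: "'a::locally_convex_space set \<Rightarrow> bool"
  where "sequentially_complete A \<longleftrightarrow>
    (\<forall>x. (\<forall>n. x n \<in> A) \<and> tvs_Cauchy x \<longrightarrow> (\<exists>a\<in>A. x \<longlonglongrightarrow> a))"

text \<open>Von Neumann boundedness; the library's \<^const>\<open>bounded\<close> is metric.\<close>

definition tvs_bounded :: "'a::locally_convex_space set \<Rightarrow> bool"
  where "tvs_bounded A \<longleftrightarrow>
    (\<forall>V. zero_neighborhood V \<longrightarrow> (\<exists>s>0. \<forall>t>s. A \<subseteq> (\<lambda>x. t *\<^sub>R x) ` V))"

abbreviation clinear :: "('a::complex_vector \<Rightarrow> 'b::complex_vector) \<Rightarrow> bool"
  where "clinear \<equiv> Vector_Spaces.linear scaleC scaleC"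

definition nb_bounded :: "('a::locally_convex_space \<Rightarrow> 'a) \<Rightarrow> bool"
  where "nb_bounded T \<longleftrightarrow> clinear T \<and> (\<exists>U. zero_neighborhood U \<and> tvs_bounded (T ` U))"

definition uniformly_null_on ::
  "'a set \<Rightarrow> (nat \<Rightarrow> 'a::locally_convex_space \<Rightarrow> 'a) \<Rightarrow> bool"
  where "uniformly_null_on A S \<longleftrightarrow>
    (\<forall>V. zero_neighborhood V \<longrightarrow> (\<exists>n0. \<forall>n>n0. S n ` A \<subseteq> V))"

definition uniformly_converges_on ::
  "'a set \<Rightarrow> (nat \<Rightarrow> 'a::locally_convex_space \<Rightarrow> 'a) \<Rightarrow> ('a \<Rightarrow> 'a) \<Rightarrow> bool"
  where "uniformly_converges_on A S L \<longleftrightarrow> uniformly_null_on A (\<lambda>n x. S n x - L x)"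

definition nb_resolvent_set :: "('a::locally_convex_space \<Rightarrow> 'a) \<Rightarrow> complex set"
  where "nb_resolvent_set T =
    {l. \<exists>a S. nb_bounded S \<and>
          (\<lambda>x. l *\<^sub>C x - T x) \<circ> (\<lambda>x. a *\<^sub>C x + S x) = id \<and>
          (\<lambda>x. a *\<^sub>C x + S x) \<circ> (\<lambda>x. l *\<^sub>C x - T x) = id}"

definition nb_spectrum :: "('a::locally_convex_space \<Rightarrow> 'a) \<Rightarrow> complex set"
  where "nb_spectrum T = - nb_resolvent_set T"

text \<open>In \<^typ>\<open>ennreal\<close> the supremum of the empty set is \<open>0\<close> and its infimum is \<open>\<infinity>\<close>,
  which are the required conventions.\<close>

definition set_modulus :: "complex set \<Rightarrow> ennreal"
  where "set_modulus A = (SUP z\<in>A. ennreal (cmod z))"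

definition nb_spectral_radius :: "('a::locally_convex_space \<Rightarrow> 'a) \<Rightarrow> ennreal"
  where "nb_spectral_radius T =
    Inf (ennreal ` {\<nu>::real. \<nu> > 0 \<and>
      (\<exists>U. zero_neighborhood U \<and>
        uniformly_null_on U (\<lambda>n x. (1 / complex_of_real \<nu> ^ n) *\<^sub>C (T ^^ n) x))})"

end

theory Submission
  imports Defs
begin

text \<open>If \<open>T\<^sup>n / \<nu>\<^sup>n\<close> tends to zero uniformly on a zero neighborhood \<open>U\<close> and \<open>\<nu> < \<bar>\<lambda>\<bar>\<close>, then
  on \<open>U\<close> a late block of the Neumann series is an absolutely convex combination of elements of any
  prescribed disc, because the numbers \<open>\<nu>\<^sup>i / \<bar>\<lambda>\<bar>\<^sup>i\<^sup>+\<^sup>1\<close> are summable. So the series is uniformly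
  Cauchy on \<open>U\<close>, and since \<open>U\<close> is absorbing it converges pointwise everywhere to a linear map
  \<open>R\<close>. The partial sums satisfy \<open>\<lambda> S\<^sub>n\<^sub>+\<^sub>1 = I + T S\<^sub>n = I + S\<^sub>n T\<close>; passing to the limit shows that
  \<open>R\<close> inverts \<open>\<lambda>I - T\<close>. Being a uniform limit on \<open>U\<close> of continuous operators, \<open>R\<close> is continuous, so
  in \<open>R = \<lambda>\<^sup>-\<^sup>1 I + T (\<lambda>\<^sup>-\<^sup>1 R)\<close> the second summand is nb-bounded and \<open>\<lambda>\<close> lies in the
  resolvent set.\<close>

section \<open>Complex-linear maps\<close>

global_interpretation complex_vector: vector_space "scaleC :: complex \<Rightarrow> 'a \<Rightarrow> 'a::complex_vector"
  by unfold_locales (simp_all add: scaleC_add_right scaleC_add_left scaleC_scaleC scaleC_one)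

lemma clinear_iff:
  fixes f :: "'a::complex_vector \<Rightarrow> 'b::complex_vector"
  shows "clinear f \<longleftrightarrow> (\<forall>x y. f (x + y) = f x + f y) \<and> (\<forall>c x. f (c *\<^sub>C x) = c *\<^sub>C f x)"
  by (simp add: Vector_Spaces.linear_iff complex_vector.vector_space_axioms)

lemma
  fixes f :: "'a::complex_vector \<Rightarrow> 'b::complex_vector"
  assumes "clinear f"
  shows clinear_add: "f (x + y) = f x + f y"
    and clinear_scaleC: "f (c *\<^sub>C x) = c *\<^sub>C f x"
    and clinear_diff: "f (x - y) = f x - f y"
    and clinear_sum: "f (sum g I) = (\<Sum>i\<in>I. f (g i))"
proof -
  interpret Vector_Spaces.linear scaleC scaleC f by (fact assms)
  show "f (x + y) = f x + f y" "f (c *\<^sub>C x) = c *\<^sub>C f x" "f (x - y) = f x - f y"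
    "f (sum g I) = (\<Sum>i\<in>I. f (g i))"
    by (simp_all add: add scale diff sum)
qed

lemma clinear_compose:
  assumes "clinear f" "clinear g"
  shows "clinear (\<lambda>x. f (g x))"
  using assms by (simp add: clinear_iff)

lemma clinear_scaleC_left: "clinear f \<Longrightarrow> clinear (\<lambda>x. c *\<^sub>C f x)"
  by (simp add: clinear_iff scaleC_add_right scaleC_scaleC mult.commute)

lemma clinear_funpow:
  fixes T :: "'a::complex_vector \<Rightarrow> 'a"
  assumes "clinear T"
  shows "clinear (T ^^ n)"
  by (induction n) (use assms in \<open>auto simp: clinear_iff\<close>)

lemma clinear_sum_fun: "(\<And>i. i \<in> I \<Longrightarrow> clinear (f i)) \<Longrightarrow> clinear (\<lambda>x. \<Sum>i\<in>I. f i x)"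
  by (simp add: clinear_iff sum.distrib complex_vector.scale_sum_right)


section \<open>Topology of complex vector spaces\<close>

lemma zero_neighborhood_iff_eventually: "zero_neighborhood U \<longleftrightarrow> (\<forall>\<^sub>F x in nhds 0. x \<in> U)"
  unfolding zero_neighborhood_def eventually_nhds by (auto simp: interior_def)

text \<open>\<open>Collect P\<close> is a zero neighborhood exactly when \<open>P\<close> holds
  eventually near 0. This links the neighborhood-based definitions with the filter calculus of
  limits.\<close>

lemma filterlim_nhds_zero_iff:
  fixes f :: "'a \<Rightarrow> 'b::{zero, topological_space}"
  shows "filterlim f (nhds 0) F \<longleftrightarrow> (\<forall>V. zero_neighborhood V \<longrightarrow> (\<forall>\<^sub>F x in F. f x \<in> V))"
proof
  assume "filterlim f (nhds 0) F"
  then show "\<forall>V. zero_neighborhood V \<longrightarrow> (\<forall>\<^sub>F x in F. f x \<in> V)"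
    by (auto simp: zero_neighborhood_iff_eventually filterlim_iff)
next
  assume *: "\<forall>V. zero_neighborhood V \<longrightarrow> (\<forall>\<^sub>F x in F. f x \<in> V)"
  show "filterlim f (nhds 0) F"
    unfolding filterlim_iff
  proof (intro allI impI)
    fix P :: "'b \<Rightarrow> bool" assume "eventually P (nhds 0)"
    then show "\<forall>\<^sub>F x in F. P (f x)"
      using *[rule_format, of "Collect P"] by (simp add: zero_neighborhood_iff_eventually)
  qed
qed

lemma tendsto_iff_diff_tendsto_zero:
  fixes f :: "'b \<Rightarrow> 'a::topological_ab_group_add"
  shows "(f \<longlongrightarrow> a) F \<longleftrightarrow> ((\<lambda>x. f x - a) \<longlongrightarrow> 0) F"
  using tendsto_diff[of f a F "\<lambda>_. a" a] tendsto_add[of "\<lambda>x. f x - a" 0 F "\<lambda>_. a" a] by auto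

text \<open>Continuity of addition at (0, 0) gives one neighborhood per summand; \<open>W\<close> is
  their intersection. It stands in for the \<epsilon>/2 argument.\<close>

lemma zero_neighborhood_half:
  fixes V :: "'a::topological_ab_group_add set"
  assumes "zero_neighborhood V"
  obtains W where "zero_neighborhood W" "\<And>x y. x \<in> W \<Longrightarrow> y \<in> W \<Longrightarrow> x + y \<in> V"
proof -
  have "\<forall>\<^sub>F p in nhds (0::'a) \<times>\<^sub>F nhds 0. fst p + snd p \<in> V"
    using tendsto_add_Pair[of "0::'a" 0] assms
    by (simp add: filterlim_nhds_zero_iff)
  then obtain P Q where PQ: "eventually P (nhds (0::'a))" "eventually Q (nhds (0::'a))"
    "\<And>x y. P x \<Longrightarrow> Q y \<Longrightarrow> x + y \<in> V"
    unfolding eventually_prod_filter by auto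
  show thesis
    by (rule that[of "{x. P x \<and> Q x}"])
      (use PQ in \<open>auto simp: zero_neighborhood_iff_eventually eventually_conj\<close>)
qed

section \<open>Scalar multiplication and convex balanced neighborhoods\<close>

lemma tendsto_scaleC:
  fixes g :: "'b \<Rightarrow> 'a::complex_tvs"
  assumes "(f \<longlongrightarrow> c) F" "(g \<longlongrightarrow> x) F"
  shows "((\<lambda>y. f y *\<^sub>C g y) \<longlongrightarrow> c *\<^sub>C x) F"
  using filterlim_compose[OF tendsto_scaleC_Pair filterlim_Pair[OF assms]] by simp

lemma tendsto_scaleC_zero:
  "filterlim (\<lambda>x. c *\<^sub>C x) (nhds 0) (nhds (0::'a::complex_tvs))"
  using tendsto_scaleC[OF tendsto_const filterlim_ident, of c "0::'a"] by simp

text \<open>The vectors \<open>x\<close> / (n + 1) tend to 0, so one of them lies in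
  \<open>U\<close>; its scalar is nonzero and can be divided out again later.\<close>

lemma zero_neighborhood_absorbing:
  fixes x :: "'a::complex_tvs"
  assumes "zero_neighborhood U"
  obtains c where "c \<noteq> 0" "c *\<^sub>C x \<in> U"
proof -
  have "(\<lambda>n. complex_of_real (inverse (real (Suc n)))) \<longlonglongrightarrow> complex_of_real 0"
    by (intro tendsto_of_real LIMSEQ_inverse_real_of_nat)
  then have "(\<lambda>n. complex_of_real (inverse (real (Suc n))) *\<^sub>C x) \<longlonglongrightarrow> 0"
    using tendsto_scaleC[OF _ tendsto_const, of _ 0 sequentially x] by simp
  then have "\<forall>\<^sub>F n in sequentially. complex_of_real (inverse (real (Suc n))) *\<^sub>C x \<in> U"
    using assms by (auto simp: filterlim_nhds_zero_iff)
  then obtain n where "complex_of_real (inverse (real (Suc n))) *\<^sub>C x \<in> U"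
    by (auto simp: eventually_sequentially)
  then show thesis
    by (rule that[rotated]) (simp del: of_nat_Suc)
qed

text \<open>\<open>D\<close> is the balanced core of a convex neighborhood \<open>V\<close>. It
  inherits convexity from \<open>V\<close>, and joint continuity of scalar multiplication at (0, 0)
  keeps it a zero neighborhood.\<close>

lemma convex_balanced_zero_neighborhood:
  fixes U :: "'a::locally_convex_space set"
  assumes "zero_neighborhood U"
  obtains D where "zero_neighborhood D" "D \<subseteq> U" "convex D"
    "\<And>c x. cmod c \<le> 1 \<Longrightarrow> x \<in> D \<Longrightarrow> c *\<^sub>C x \<in> D"
proof -
  obtain V where V: "zero_neighborhood V" "convex V" "V \<subseteq> U"
    using locally_convex[OF assms] by blast
  define D where "D = {x. \<forall>c. cmod c \<le> 1 \<longrightarrow> c *\<^sub>C x \<in> V}"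
  have "\<forall>\<^sub>F p in nhds (0::complex) \<times>\<^sub>F nhds (0::'a). fst p *\<^sub>C snd p \<in> V"
    using tendsto_scaleC_Pair[of 0 "0::'a"] V(1) by (simp add: filterlim_nhds_zero_iff)
  then obtain P Q where PQ: "eventually P (nhds (0::complex))" "eventually Q (nhds (0::'a))"
    "\<And>c x. P c \<Longrightarrow> Q x \<Longrightarrow> c *\<^sub>C x \<in> V"
    unfolding eventually_prod_filter by auto
  obtain d where d: "d > 0" "\<And>c. cmod c < d \<Longrightarrow> P c"
    using PQ(1) by (auto simp: eventually_nhds_metric)
  have "\<forall>\<^sub>F x in nhds (0::'a). Q (complex_of_real (2 / d) *\<^sub>C x)"
    using tendsto_scaleC_zero PQ(2) by (auto simp: filterlim_iff)
  \<comment> \<open>Writing \<open>c\<close> as (\<open>c\<close> d/2)(2/d) makes the first factor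
    smaller than \<open>d\<close> in modulus whenever \<open>c\<close> lies in the closed unit disc,
    so a single condition on (2/d) \<open>x\<close> handles all these \<open>c\<close> at
    once.\<close>
  moreover have "x \<in> D" if "Q (complex_of_real (2 / d) *\<^sub>C x)" for x
    unfolding D_def
  proof safe
    fix c :: complex assume "cmod c \<le> 1"
    then have "cmod (c * complex_of_real (d / 2)) < d"
      using d(1) by (simp add: norm_mult)
    then have "(c * complex_of_real (d / 2)) *\<^sub>C (complex_of_real (2 / d) *\<^sub>C x) \<in> V"
      using d(2) PQ(3) that by blast
    then show "c *\<^sub>C x \<in> V"
      using d(1) by (simp add: scaleC_scaleC)
  qed
  ultimately have "zero_neighborhood D"
    unfolding zero_neighborhood_iff_eventually by (rule eventually_mono)
  moreover have "D \<subseteq> U"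
  proof
    fix x assume "x \<in> D"
    then have "\<forall>c. cmod c \<le> 1 \<longrightarrow> c *\<^sub>C x \<in> V" by (simp add: D_def)
    from spec[OF this, of 1] show "x \<in> U" using V(3) by auto
  qed
  moreover have "convex D"
  proof (rule convexI)
    fix x y and u v :: real
    assume xy: "x \<in> D" "y \<in> D" and uv: "0 \<le> u" "0 \<le> v" "u + v = 1"
    show "u *\<^sub>R x + v *\<^sub>R y \<in> D"
      unfolding D_def
    proof safe
      fix c :: complex assume "cmod c \<le> 1"
      then have "u *\<^sub>R (c *\<^sub>C x) + v *\<^sub>R (c *\<^sub>C y) \<in> V"
        using xy uv V(2) by (intro convexD) (auto simp: D_def)
      then show "c *\<^sub>C (u *\<^sub>R x + v *\<^sub>R y) \<in> V"
        by (simp add: scaleR_scaleC scaleC_add_right scaleC_scaleC mult.commute)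
    qed
  qed
  moreover have "c *\<^sub>C x \<in> D" if "cmod c \<le> 1" "x \<in> D" for c x
    using that unfolding D_def by (simp add: scaleC_scaleC norm_mult mult_le_one)
  ultimately show thesis by (rule that)
qed

text \<open>Balancedness absorbs the phases of the coefficients, convexity combines the remaining
  nonnegative weights, and balancedness once more absorbs a total weight of at most 1.\<close>

lemma convex_balanced_sum:
  fixes D :: "'a::locally_convex_space set" and c :: "'i \<Rightarrow> complex"
  assumes D: "zero_neighborhood D" "convex D" "\<And>c x. cmod c \<le> 1 \<Longrightarrow> x \<in> D \<Longrightarrow> c *\<^sub>C x \<in> D"
    and "finite I" "\<And>i. i \<in> I \<Longrightarrow> v i \<in> D" "(\<Sum>i\<in>I. cmod (c i)) \<le> 1"
  shows "(\<Sum>i\<in>I. c i *\<^sub>C v i) \<in> D"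
proof -
  have "0 \<in> D"
    using D(1) interior_subset by (auto simp: zero_neighborhood_def)
  \<comment> \<open>The induction factors out the exact total weight, so that the vector
    \<open>w\<close> left over is a normalized convex combination; no bound on the weight is needed
    at this stage.\<close>
  have "\<exists>w\<in>D. (\<Sum>i\<in>I. c i *\<^sub>C v i) = (\<Sum>i\<in>I. cmod (c i)) *\<^sub>R w"
    using assms(4,5)
  proof (induction I rule: finite_induct)
    case empty
    then show ?case using \<open>0 \<in> D\<close> by auto
  next
    case (insert j I)
    obtain w where w: "w \<in> D" "(\<Sum>i\<in>I. c i *\<^sub>C v i) = (\<Sum>i\<in>I. cmod (c i)) *\<^sub>R w"
      using insert by auto
    define s where "s = (\<Sum>i\<in>I. cmod (c i))"
    have s: "s \<ge> 0" unfolding s_def by (simp add: sum_nonneg)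
    \<comment> \<open>The phase of \<open>c j\<close> moves into the vector, leaving the real weight
      \<open>cmod (c j)\<close>.\<close>
    have u: "sgn (c j) *\<^sub>C v j \<in> D"
      using insert.prems by (intro D(3)) (auto simp: norm_sgn)
    have cj: "c j *\<^sub>C v j = cmod (c j) *\<^sub>R (sgn (c j) *\<^sub>C v j)"
      by (simp add: scaleR_scaleC scaleC_scaleC sgn_eq)
    show ?case
    proof (cases "cmod (c j) + s = 0")
      \<comment> \<open>Weights of total 0 cannot be normalized, but then every term vanishes and
        any element of \<open>D\<close> serves.\<close>
      case True
      then have "cmod (c j) = 0" "s = 0" using s by (smt (verit) norm_ge_zero)+
      then show ?thesis
        using \<open>0 \<in> D\<close> insert.hyps w(2) by (auto simp: s_def[symmetric])
    next
      case False
      let ?t = "cmod (c j) + s"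
      let ?w = "(cmod (c j) / ?t) *\<^sub>R (sgn (c j) *\<^sub>C v j) + (s / ?t) *\<^sub>R w"
      have "?w \<in> D"
        using False s u w(1) by (intro convexD[OF D(2)]) (auto simp flip: add_divide_distrib)
      moreover have "c j *\<^sub>C v j + s *\<^sub>R w = ?t *\<^sub>R ?w"
        using False by (subst cj) (simp add: scaleR_add_right)
      ultimately show ?thesis
        using insert.hyps w(2) by (auto simp: s_def[symmetric])
    qed
  qed
  then obtain w where "w \<in> D" "(\<Sum>i\<in>I. c i *\<^sub>C v i) = complex_of_real (\<Sum>i\<in>I. cmod (c i)) *\<^sub>C w"
    by (auto simp: scaleR_scaleC)
  moreover have "cmod (complex_of_real (\<Sum>i\<in>I. cmod (c i))) \<le> 1"
    using assms(6) by (simp add: sum_nonneg del: of_real_sum)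
  ultimately show ?thesis using D(3) by metis
qed

section \<open>Continuity of operators and nb-boundedness\<close>

lemma clinear_tendsto:
  fixes T :: "'a::locally_convex_space \<Rightarrow> 'a"
  assumes "clinear T" "filterlim T (nhds 0) (nhds 0)" "(f \<longlongrightarrow> a) F"
  shows "((\<lambda>x. T (f x)) \<longlongrightarrow> T a) F"
proof -
  have "((\<lambda>x. f x - a) \<longlongrightarrow> 0) F"
    using assms(3) by (rule tendsto_iff_diff_tendsto_zero[THEN iffD1])
  then have "((\<lambda>x. T (f x) - T a) \<longlongrightarrow> 0) F"
    using filterlim_compose[OF assms(2)] by (simp only: clinear_diff[OF assms(1), symmetric])
  then show ?thesis by (rule tendsto_iff_diff_tendsto_zero[THEN iffD2])
qed

text \<open>If \<open>T\<close> maps \<open>U\<close> into t V, then by homogeneity it maps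
  \<open>U\<close> shrunk by the factor t into V.\<close>

lemma nb_bounded_imp_tendsto_zero:
  assumes "nb_bounded T"
  shows "filterlim T (nhds 0) (nhds 0)"
  unfolding filterlim_nhds_zero_iff
proof (intro allI impI)
  fix V :: "'a set" assume "zero_neighborhood V"
  obtain U where T: "clinear T" and U: "zero_neighborhood U" "tvs_bounded (T ` U)"
    using assms unfolding nb_bounded_def by blast
  obtain s where s: "s > 0" "\<forall>t>s. T ` U \<subseteq> (\<lambda>x. t *\<^sub>R x) ` V"
    using U(2) \<open>zero_neighborhood V\<close> unfolding tvs_bounded_def by blast
  \<comment> \<open>Absorption is only granted for factors strictly above \<open>s\<close>.\<close>
  let ?t = "s + 1"
  have "\<forall>\<^sub>F x in nhds 0. complex_of_real ?t *\<^sub>C x \<in> U"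
    using tendsto_scaleC_zero[of "complex_of_real ?t"] U(1)
    unfolding filterlim_nhds_zero_iff by blast
  then show "\<forall>\<^sub>F x in nhds 0. T x \<in> V"
  proof (rule eventually_mono)
    fix x assume "complex_of_real ?t *\<^sub>C x \<in> U"
    then obtain y where "y \<in> V" "T (complex_of_real ?t *\<^sub>C x) = ?t *\<^sub>R y"
      using s(2)[rule_format, of ?t] by auto
    then have "?t *\<^sub>R T x = ?t *\<^sub>R y"
      by (simp only: clinear_scaleC[OF T] scaleR_scaleC)
    then show "T x \<in> V" using s(1) \<open>y \<in> V\<close> by simp
  qed
qed

lemma nb_bounded_compose_tendsto_zero:
  assumes "nb_bounded T" "clinear R" "filterlim R (nhds 0) (nhds 0)"
  shows "nb_bounded (\<lambda>x. T (R x))"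
proof -
  obtain U where U: "clinear T" "zero_neighborhood U" "tvs_bounded (T ` U)"
    using assms(1) unfolding nb_bounded_def by blast
  have "zero_neighborhood (R -` U)"
    using assms(3) U(2) unfolding filterlim_nhds_zero_iff
    by (simp add: zero_neighborhood_iff_eventually)
  moreover have "tvs_bounded ((\<lambda>x. T (R x)) ` (R -` U))"
    unfolding tvs_bounded_def
  proof (intro allI impI)
    fix V :: "'a set" assume "zero_neighborhood V"
    then obtain s where "s > 0" "\<forall>t>s. T ` U \<subseteq> (\<lambda>x. t *\<^sub>R x) ` V"
      using U(3) unfolding tvs_bounded_def by metis
    moreover have "(\<lambda>x. T (R x)) ` (R -` U) \<subseteq> T ` U" by auto
    ultimately show "\<exists>s>0. \<forall>t>s. (\<lambda>x. T (R x)) ` (R -` U) \<subseteq> (\<lambda>x. t *\<^sub>R x) ` V"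
      by (meson order_trans)
  qed
  ultimately have "\<exists>W. zero_neighborhood W \<and> tvs_bounded ((\<lambda>x. T (R x)) ` W)"
    by (intro exI conjI)
  then show ?thesis
    unfolding nb_bounded_def by (rule conjI[OF clinear_compose[OF U(1) assms(2)]])
qed

text \<open>Split \<open>R\<close> as \<open>S n\<close> plus \<open>R - S n\<close>: for one fixed
  \<open>n\<close> the difference is small on all of \<open>U\<close>, and \<open>S n\<close> is
  small near 0 by its own continuity.\<close>

lemma uniformly_converges_on_tendsto_zero:
  assumes U: "zero_neighborhood U" and lim: "uniformly_converges_on U S R"
    and S: "\<And>n. filterlim (S n) (nhds 0) (nhds 0)"
  shows "filterlim R (nhds 0) (nhds 0)"
  unfolding filterlim_nhds_zero_iff
proof (intro allI impI)
  fix V :: "'a set" assume "zero_neighborhood V"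
  then obtain W where W: "zero_neighborhood W" "\<And>x y. x \<in> W \<Longrightarrow> y \<in> W \<Longrightarrow> x + y \<in> V"
    using zero_neighborhood_half by blast
  obtain D where D: "zero_neighborhood D" "D \<subseteq> W"
    "\<And>c x. cmod c \<le> 1 \<Longrightarrow> x \<in> D \<Longrightarrow> c *\<^sub>C x \<in> D"
    using convex_balanced_zero_neighborhood[OF W(1)] by metis
  obtain n where n: "\<And>x. x \<in> U \<Longrightarrow> S n x - R x \<in> D"
    using lim D(1) unfolding uniformly_converges_on_def uniformly_null_on_def by blast
  have "\<forall>\<^sub>F x in nhds 0. x \<in> U \<and> S n x \<in> D"
    using S[of n] U D(1)
    by (simp add: filterlim_nhds_zero_iff zero_neighborhood_iff_eventually eventually_conj)
  then show "\<forall>\<^sub>F x in nhds 0. R x \<in> V"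
  proof (rule eventually_mono)
    fix x assume x: "x \<in> U \<and> S n x \<in> D"
    \<comment> \<open>Balancedness with the scalar -1 reverses the difference.\<close>
    then have "- 1 *\<^sub>C (S n x - R x) \<in> D"
      using n by (intro D(3)) auto
    then have "R x - S n x \<in> W"
      using D(2) by (auto simp: complex_vector.scale_minus_left scaleC_one)
    then have "S n x + (R x - S n x) \<in> V"
      using x D(2) W(2) by blast
    then show "R x \<in> V" by simp
  qed
qed


section \<open>The Neumann series\<close>

definition neumann_sum :: "('a::complex_vector \<Rightarrow> 'a) \<Rightarrow> complex \<Rightarrow> nat \<Rightarrow> 'a \<Rightarrow> 'a"
  where "neumann_sum T l n x = (\<Sum>i\<le>n. (1 / l ^ (i + 1)) *\<^sub>C (T ^^ i) x)"

lemma clinear_neumann_sum: "clinear T \<Longrightarrow> clinear (neumann_sum T l n)"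
  unfolding neumann_sum_def by (intro clinear_sum_fun clinear_scaleC_left clinear_funpow)

lemma neumann_sum_tendsto_zero:
  fixes T :: "'a::complex_tvs \<Rightarrow> 'a"
  assumes "filterlim T (nhds 0) (nhds 0)"
  shows "filterlim (neumann_sum T l n) (nhds 0) (nhds 0)"
proof -
  have "filterlim (T ^^ i) (nhds 0) (nhds 0)" for i
  proof (induction i)
    case (Suc i)
    then show ?case using filterlim_compose[OF assms] by (simp add: o_def)
  qed (simp add: filterlim_ident)
  then have "filterlim (\<lambda>x. (1 / l ^ (i + 1)) *\<^sub>C (T ^^ i) x) (nhds 0) (nhds 0)" for i
    using filterlim_compose[OF tendsto_scaleC_zero] by blast
  then have "((\<lambda>x. \<Sum>i\<le>n. (1 / l ^ (i + 1)) *\<^sub>C (T ^^ i) x) \<longlongrightarrow> (\<Sum>i\<le>n. 0)) (nhds 0)"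
    by (intro tendsto_sum)
  then show ?thesis by (simp add: neumann_sum_def[abs_def])
qed

text \<open>Multiplication by \<open>l\<close> lowers each exponent of \<open>l\<close> by one: the
  term of index 0 becomes \<open>x\<close>, and the term of index i + 1 at \<open>x\<close> becomes
  the term of index i at \<open>T x\<close>.\<close>

lemma neumann_sum_Suc_right:
  assumes "l \<noteq> 0"
  shows "l *\<^sub>C neumann_sum T l (Suc n) x = x + neumann_sum T l n (T x)"
proof -
  have "l *\<^sub>C (1 / l ^ (Suc i + 1)) *\<^sub>C (T ^^ Suc i) x = (1 / l ^ (i + 1)) *\<^sub>C (T ^^ i) (T x)" for i
    using assms by (simp add: scaleC_scaleC funpow_Suc_right del: funpow.simps(2))
  then show ?thesis
    unfolding neumann_sum_def sum.atMost_Suc_shift complex_vector.scale_sum_right scaleC_add_right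
    using assms by (simp add: scaleC_scaleC scaleC_one)
qed

text \<open>This lets the preceding recursion be read with \<open>T\<close> on either side of the
  partial sum, which yields both a right and a left inverse in the limit.\<close>

lemma neumann_sum_commute:
  assumes "clinear T"
  shows "neumann_sum T l n (T x) = T (neumann_sum T l n x)"
  unfolding neumann_sum_def
  by (simp add: clinear_sum[OF assms] clinear_scaleC[OF assms] funpow_swap1)

lemma neumann_sum_uniformly_Cauchy:
  fixes T :: "'a::locally_convex_space \<Rightarrow> 'a"
  assumes null: "uniformly_null_on U (\<lambda>n x. (1 / complex_of_real \<nu> ^ n) *\<^sub>C (T ^^ n) x)"
    and \<nu>: "0 < \<nu>" "\<nu> < cmod l" and V: "zero_neighborhood V"
  shows "\<exists>N. \<forall>m\<ge>N. \<forall>n\<ge>N. \<forall>x\<in>U. neumann_sum T l m x - neumann_sum T l n x \<in> V"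
proof -
  obtain D where D: "zero_neighborhood D" "D \<subseteq> V" "convex D"
    "\<And>c x. cmod c \<le> 1 \<Longrightarrow> x \<in> D \<Longrightarrow> c *\<^sub>C x \<in> D"
    using convex_balanced_zero_neighborhood[OF V] by metis
  obtain N1 where N1: "\<And>n x. n > N1 \<Longrightarrow> x \<in> U \<Longrightarrow> (1 / complex_of_real \<nu> ^ n) *\<^sub>C (T ^^ n) x \<in> D"
    using null D(1) unfolding uniformly_null_on_def by blast
  \<comment> \<open>The weights relating the two scalings: T^i / l^(i+1) is \<open>q i\<close> times
    T^i / \<nu>^i, and \<open>cmod (q i)\<close> is geometric with ratio \<nu> / |l| < 1.\<close>
  define q where "q i = complex_of_real \<nu> ^ i / l ^ (i + 1)" for i
  have "cmod (q i) = (\<nu> / cmod l) ^ i / cmod l" for i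
    using \<nu> by (simp add: q_def norm_divide norm_mult norm_power power_divide mult.commute)
  moreover have "summable (\<lambda>i. (\<nu> / cmod l) ^ i / cmod l)"
    using \<nu> by (intro summable_divide summable_geometric) (simp add: divide_less_eq)
  ultimately have "summable (\<lambda>i. cmod (q i))" by simp
  then obtain N2 where N2: "\<And>m n. m \<ge> N2 \<Longrightarrow> norm (\<Sum>i\<in>{m..<n}. cmod (q i)) < 1"
    unfolding summable_Cauchy by (metis zero_less_one)
  let ?N = "max N1 N2"
  have block: "neumann_sum T l n x - neumann_sum T l m x \<in> D"
    if "?N \<le> m" "m \<le> n" "x \<in> U" for m n x
  proof -
    \<comment> \<open>The difference starts at exponent \<open>Suc m\<close>, which strictly exceeds
      \<open>N1\<close> as the choice of \<open>N1\<close> demands; the half-open interval matches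
      the Cauchy criterion behind \<open>N2\<close>.\<close>
    have "neumann_sum T l n x - neumann_sum T l m x
        = (\<Sum>i\<in>{Suc m..<Suc n}. (1 / l ^ (i + 1)) *\<^sub>C (T ^^ i) x)"
    proof -
      have "{..n} - {..m} = {Suc m..<Suc n}" by auto
      moreover have "{..m} \<subseteq> {..n}" using that by auto
      ultimately show ?thesis
        unfolding neumann_sum_def by (simp only: finite_atMost sum_diff[symmetric])
    qed
    also have "\<dots> = (\<Sum>i\<in>{Suc m..<Suc n}. q i *\<^sub>C ((1 / complex_of_real \<nu> ^ i) *\<^sub>C (T ^^ i) x))"
      using \<nu> by (simp add: q_def scaleC_scaleC)
    also have "\<dots> \<in> D"
    proof (rule convex_balanced_sum[OF D(1,3,4)])
      show "(1 / complex_of_real \<nu> ^ i) *\<^sub>C (T ^^ i) x \<in> D" if "i \<in> {Suc m..<Suc n}" for i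
        using that \<open>?N \<le> m\<close> \<open>x \<in> U\<close> by (intro N1) auto
      show "(\<Sum>i\<in>{Suc m..<Suc n}. cmod (q i)) \<le> 1"
        using N2[of "Suc m" "Suc n"] \<open>?N \<le> m\<close> by simp
    qed auto
    finally show ?thesis .
  qed
  have "neumann_sum T l m x - neumann_sum T l n x \<in> V" if "?N \<le> m" "?N \<le> n" "x \<in> U" for m n x
  proof (cases "n \<le> m")
    case True
    then show ?thesis using block that D(2) by blast
  next
    case False
    then have "- 1 *\<^sub>C (neumann_sum T l n x - neumann_sum T l m x) \<in> D"
      using that by (intro D(4) block) auto
    then show ?thesis
      using D(2) by (auto simp: complex_vector.scale_minus_left scaleC_one)
  qed
  then show ?thesis by blast
qed

text \<open>The uniform Cauchy property gives pointwise limits through sequential completeness;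
  linearity passes to the limit, and uniform convergence follows because the Cauchy index does not
  depend on the point of \<open>U\<close>.\<close>

lemma neumann_series_converges:
  fixes T :: "'a::locally_convex_space \<Rightarrow> 'a"
  assumes complete: "sequentially_complete (UNIV :: 'a set)" and T: "clinear T"
    and U: "zero_neighborhood U"
    and null: "uniformly_null_on U (\<lambda>n x. (1 / complex_of_real \<nu> ^ n) *\<^sub>C (T ^^ n) x)"
    and \<nu>: "0 < \<nu>" "\<nu> < cmod l"
  obtains R where "\<And>x. (\<lambda>n. neumann_sum T l n x) \<longlonglongrightarrow> R x" "clinear R"
    "uniformly_converges_on U (neumann_sum T l) R"
proof -
  note Cauchy = neumann_sum_uniformly_Cauchy[OF null \<nu>]
  have "\<exists>a. (\<lambda>n. neumann_sum T l n x) \<longlonglongrightarrow> a" for x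
  proof -
    \<comment> \<open>The Cauchy estimate is available only on \<open>U\<close>, so \<open>x\<close>
      is scaled into \<open>U\<close> and the limit is scaled back by 1/c.\<close>
    obtain c where c: "c \<noteq> 0" "c *\<^sub>C x \<in> U"
      using zero_neighborhood_absorbing[OF U] by blast
    have "tvs_Cauchy (\<lambda>n. neumann_sum T l n (c *\<^sub>C x))"
      unfolding tvs_Cauchy_def using Cauchy c(2) by meson
    then obtain a where "(\<lambda>n. neumann_sum T l n (c *\<^sub>C x)) \<longlonglongrightarrow> a"
      using complete unfolding sequentially_complete_def by auto
    then have "(\<lambda>n. (1 / c) *\<^sub>C neumann_sum T l n (c *\<^sub>C x)) \<longlonglongrightarrow> (1 / c) *\<^sub>C a"
      by (intro tendsto_scaleC tendsto_const)
    then show ?thesis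
      using c(1)
      by (auto simp: clinear_scaleC[OF clinear_neumann_sum[OF T]] scaleC_scaleC scaleC_one)
  qed
  then obtain R where R: "\<And>x. (\<lambda>n. neumann_sum T l n x) \<longlonglongrightarrow> R x" by metis
  have "clinear R"
    unfolding clinear_iff
  proof safe
    fix x y
    have "(\<lambda>n. neumann_sum T l n (x + y)) \<longlonglongrightarrow> R x + R y"
      using tendsto_add[OF R R] by (simp add: clinear_add[OF clinear_neumann_sum[OF T]])
    then show "R (x + y) = R x + R y" using R LIMSEQ_unique by blast
  next
    fix c x
    have "(\<lambda>n. neumann_sum T l n (c *\<^sub>C x)) \<longlonglongrightarrow> c *\<^sub>C R x"
      using tendsto_scaleC[OF tendsto_const R]
      by (simp add: clinear_scaleC[OF clinear_neumann_sum[OF T]])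
    then show "R (c *\<^sub>C x) = c *\<^sub>C R x" using R LIMSEQ_unique by blast
  qed
  moreover have "uniformly_converges_on U (neumann_sum T l) R"
    unfolding uniformly_converges_on_def uniformly_null_on_def
  proof (intro allI impI)
    fix V :: "'a set" assume "zero_neighborhood V"
    then obtain W where W: "zero_neighborhood W" "\<And>x y. x \<in> W \<Longrightarrow> y \<in> W \<Longrightarrow> x + y \<in> V"
      using zero_neighborhood_half by blast
    obtain N where N: "\<And>m n x. m \<ge> N \<Longrightarrow> n \<ge> N \<Longrightarrow> x \<in> U \<Longrightarrow>
        neumann_sum T l m x - neumann_sum T l n x \<in> W"
      using Cauchy[OF W(1)] by blast
    \<comment> \<open>The intermediate index \<open>m\<close> found below may depend on
      \<open>x\<close>; the threshold \<open>N\<close> does not, and this is what uniformity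
      requires.\<close>
    have "neumann_sum T l n x - R x \<in> V" if "n > N" "x \<in> U" for n x
    proof -
      have "(\<lambda>m. neumann_sum T l m x - R x) \<longlonglongrightarrow> 0"
        using R[of x] by (simp only: tendsto_iff_diff_tendsto_zero[symmetric])
      then have "\<forall>\<^sub>F m in sequentially. neumann_sum T l m x - R x \<in> W"
        using W(1) by (simp add: filterlim_nhds_zero_iff)
      then have "\<forall>\<^sub>F m in sequentially. m \<ge> N \<and> neumann_sum T l m x - R x \<in> W"
        by (intro eventually_conj eventually_ge_at_top)
      then obtain m where m: "m \<ge> N" "neumann_sum T l m x - R x \<in> W"
        using eventually_happens'[OF sequentially_bot] by blast
      have "(neumann_sum T l n x - neumann_sum T l m x) + (neumann_sum T l m x - R x) \<in> V"
        using that m by (intro W(2) N) auto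
      then show ?thesis by simp
    qed
    then show "\<exists>n0. \<forall>n>n0. (\<lambda>x. neumann_sum T l n x - R x) ` U \<subseteq> V" by blast
  qed
  ultimately show thesis using R that by blast
qed

section \<open>The resolvent and the spectral bound\<close>

lemma neumann_resolvent:
  fixes T :: "'a::locally_convex_space \<Rightarrow> 'a"
  assumes complete: "sequentially_complete (UNIV :: 'a set)" and T: "nb_bounded T"
    and l: "nb_spectral_radius T < ennreal (cmod l)"
  obtains R U where "\<And>x. l *\<^sub>C R x - T (R x) = x" "\<And>x. R (l *\<^sub>C x - T x) = x" "clinear R"
    "filterlim R (nhds 0) (nhds 0)" "zero_neighborhood U"
    "uniformly_converges_on U (neumann_sum T l) R"
proof -
  have lin: "clinear T" using T unfolding nb_bounded_def by blast
  note cont = nb_bounded_imp_tendsto_zero[OF T]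
  \<comment> \<open>The radius is an infimum lying strictly below |l|, so some admissible \<nu>
    already lies below |l|.\<close>
  obtain \<nu> U where \<nu>: "0 < \<nu>" "\<nu> < cmod l" and U: "zero_neighborhood U"
    "uniformly_null_on U (\<lambda>n x. (1 / complex_of_real \<nu> ^ n) *\<^sub>C (T ^^ n) x)"
    using l unfolding nb_spectral_radius_def Inf_less_iff by (auto simp: ennreal_less_iff)
  have "l \<noteq> 0" using \<nu> by auto
  obtain R where R: "\<And>x. (\<lambda>n. neumann_sum T l n x) \<longlonglongrightarrow> R x" "clinear R"
    "uniformly_converges_on U (neumann_sum T l) R"
    using neumann_series_converges[OF complete lin U \<nu>] by blast
  \<comment> \<open>One sequence is given three limits, \<open>l\<close> R x, x + T (R x) and x + R
    (T x). Uniqueness of limits in a Hausdorff space turns them into the two inverse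
    identities.\<close>
  have lim: "(\<lambda>n. l *\<^sub>C neumann_sum T l (Suc n) x) \<longlonglongrightarrow> l *\<^sub>C R x" for x
    by (rule tendsto_scaleC[OF tendsto_const LIMSEQ_Suc[OF R(1)]])
  have "(\<lambda>n. l *\<^sub>C neumann_sum T l (Suc n) x) \<longlonglongrightarrow> x + T (R x)" for x
    unfolding neumann_sum_Suc_right[OF \<open>l \<noteq> 0\<close>] neumann_sum_commute[OF lin]
    by (rule tendsto_add[OF tendsto_const clinear_tendsto[OF lin cont R(1)]])
  then have TR: "l *\<^sub>C R x = x + T (R x)" for x
    using LIMSEQ_unique[OF lim] by simp
  have "(\<lambda>n. l *\<^sub>C neumann_sum T l (Suc n) x) \<longlonglongrightarrow> x + R (T x)" for x
    unfolding neumann_sum_Suc_right[OF \<open>l \<noteq> 0\<close>]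
    by (rule tendsto_add[OF tendsto_const R(1)])
  then have RT: "l *\<^sub>C R x = x + R (T x)" for x
    using LIMSEQ_unique[OF lim] by simp
  show thesis
  proof (rule that[OF _ _ R(2) _ U(1) R(3)])
    show "l *\<^sub>C R x - T (R x) = x" for x
      by (simp add: TR)
    show "R (l *\<^sub>C x - T x) = x" for x
      by (simp add: RT clinear_diff[OF R(2)] clinear_scaleC[OF R(2)])
    show "filterlim R (nhds 0) (nhds 0)"
      by (rule uniformly_converges_on_tendsto_zero[OF U(1) R(3) neumann_sum_tendsto_zero[OF cont]])
  qed
qed

lemma spectral_radius_less_imp_nb_resolvent:
  fixes T :: "'a::locally_convex_space \<Rightarrow> 'a"
  assumes complete: "sequentially_complete (UNIV :: 'a set)" and T: "nb_bounded T"
    and l: "nb_spectral_radius T < ennreal (cmod l)"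
  shows "l \<in> nb_resolvent_set T"
proof -
  obtain R U where R: "\<And>x. l *\<^sub>C R x - T (R x) = x" "\<And>x. R (l *\<^sub>C x - T x) = x"
    "clinear R" "filterlim R (nhds 0) (nhds 0)"
    and "zero_neighborhood U" "uniformly_converges_on U (neumann_sum T l) R"
    by (rule neumann_resolvent[OF assms]) (rule that)
  have "l \<noteq> 0" using l by auto
  have lin: "clinear T" using T unfolding nb_bounded_def by blast
  \<comment> \<open>The scalar 1/l sits inside \<open>T\<close>, so that \<open>?S\<close> is
    literally \<open>T\<close> composed with the continuous operator (1/l) R; the scalar part of the
    resolvent is 1/l as well.\<close>
  let ?S = "\<lambda>x. T ((1 / l) *\<^sub>C R x)"
  have "nb_bounded ?S"
    by (rule nb_bounded_compose_tendsto_zero[OF T clinear_scaleC_left[OF R(3)]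
          filterlim_compose[OF tendsto_scaleC_zero R(4)]])
  moreover have "(1 / l) *\<^sub>C x + ?S x = R x" for x
  proof -
    have "(1 / l) *\<^sub>C x + ?S x = (1 / l) *\<^sub>C (x + T (R x))"
      by (simp add: clinear_scaleC[OF lin] scaleC_add_right)
    also have "x + T (R x) = l *\<^sub>C R x"
      using R(1)[of x] by (simp add: algebra_simps)
    finally show ?thesis using \<open>l \<noteq> 0\<close> by (simp add: scaleC_scaleC scaleC_one)
  qed
  ultimately show ?thesis
    unfolding nb_resolvent_set_def
    by (intro CollectI exI[of _ "1 / l"] exI[of _ ?S]) (simp add: fun_eq_iff R(1,2))
qed

theorem theorem5p5:
  fixes T :: "'a::locally_convex_space \<Rightarrow> 'a" and l :: complex
  assumes "sequentially_complete (UNIV :: 'a set)"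
    and "nb_bounded T"
  shows "(ennreal (cmod l) > nb_spectral_radius T \<longrightarrow>
      bij (\<lambda>x. l *\<^sub>C x - T x) \<and>
      (\<exists>U. zero_neighborhood U \<and>
        uniformly_converges_on U
          (\<lambda>n x. \<Sum>i\<le>n. (1 / l ^ (i + 1)) *\<^sub>C (T ^^ i) x)
          (inv (\<lambda>x. l *\<^sub>C x - T x)))) \<and>
    set_modulus (nb_spectrum T) \<le> nb_spectral_radius T"
proof (intro conjI impI)
  assume l: "nb_spectral_radius T < ennreal (cmod l)"
  obtain R U where R: "\<And>x. l *\<^sub>C R x - T (R x) = x" "\<And>x. R (l *\<^sub>C x - T x) = x"
    and "clinear R" "filterlim R (nhds 0) (nhds 0)"
    and U: "zero_neighborhood U" "uniformly_converges_on U (neumann_sum T l) R"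
    by (rule neumann_resolvent[OF assms l]) (rule that)
  show "bij (\<lambda>x. l *\<^sub>C x - T x)"
    by (rule o_bij[of R]) (auto simp: R fun_eq_iff)
  \<comment> \<open>The two-sided inverse \<open>R\<close> is identified with \<open>inv\<close>, so
    convergence to \<open>R\<close> is the required statement.\<close>
  have "inv (\<lambda>x. l *\<^sub>C x - T x) = R"
    by (rule inv_equality) (simp_all add: R)
  then show "\<exists>U. zero_neighborhood U \<and> uniformly_converges_on U
      (\<lambda>n x. \<Sum>i\<le>n. (1 / l ^ (i + 1)) *\<^sub>C (T ^^ i) x) (inv (\<lambda>x. l *\<^sub>C x - T x))"
    using U by (auto simp: neumann_sum_def[abs_def])
next
  show "set_modulus (nb_spectrum T) \<le> nb_spectral_radius T"
    unfolding set_modulus_def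
  proof (rule SUP_least)
    \<comment> \<open>By contraposition: a point of modulus above the radius belongs to the
      resolvent set. An empty spectrum or an infinite radius needs no separate case.\<close>
    fix z assume "z \<in> nb_spectrum T"
    then show "ennreal (cmod z) \<le> nb_spectral_radius T"
      using spectral_radius_less_imp_nb_resolvent[OF assms, of z]
      by (auto simp: nb_spectrum_def not_less[symmetric])
  qed
qed

end
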